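(* Suppose that in each slot $t$ every aggregator $k$ bids the curve $u_k^{(t)}(x)=\int_0^xh_k^{(t)}(\xi)\,d\xi$, and let $(p_i^*(t))_i,(x_k^*(t))_k$ be an optimal solution of the market clearing (social welfare maximization) problem P3, with associated locational marginal prices $\pi_k^*(t)$. Then the EV charging schedule determined by P3 aligns with the interest of each price-taking aggregator, i.e. $$x_k^*(t)=\sum_{g=1}^{G_k}\hat x_{kg}\big(t;\pi_k^*(t)\big)\qquad\text{for all }k\text{ and all }t,$$ where $(\hat x_{kg}(t;\pi_k^*(t)))_{g=1}^{G_k}$ is the optimal solution of aggregator $k$'s problem P2 with electricity price $\pi_k^*(t)$.
   Context: There are $I$ generators, $J$ fixed loads $d_j(t)$ and $K$ electric vehicle (EV) aggregators. Aggregator $k$ has $G_k$ groups of EVs; group $g$ has maximum charging power $X_{kg}(t)>0$ and queue backlogs $q_{kg}(t),z_{kg}(t)\ge0$, given in slot $t$. Put $X_k(t)=\sum_{g=1}^{G_k}X_{kg}(t)$; $V>0$ is a constant. Problem P2 of aggregator $k$ at price $\pi\ge 0$: minimize $\sum_{g=1}^{G_k}(V\pi-q_{kg}(t)-z_{kg}(t))x_g+\sum_{g=1}^{G_k}\frac12x_g^2$ subject to $0\le x_g\le X_{kg}(t)$ for all $g$. Its (unique) optimal solution is denoted $\hat x_{kg}(t;\pi)$; put $\hat x_k(t;\pi)=\sum_g\hat x_{kg}(t;\pi)$, a continuous nonincreasing piecewise linear function of $\pi\ge 0$. Bidding curve: $h_k^{(t)}$ is the inverse of $\pi\mapsto\hat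 x_k(t;\pi)$ on $[0,\infty)$, i.e. $h_k^{(t)}(x)$ is a price $\pi\ge 0$ with $\hat x_k(t;\pi)=x$ (at the finitely many $x$ where $\pi$ is not unique any choice may be made), and $u_k^{(t)}(x)=\int_0^xh_k^{(t)}(\xi)\,d\xi$ for $0\le x\le X_k(t)$. If $\hat x_k(t;0)<X_k(t)$, the domain of $u_k^{(t)}$ shrinks to $[0,\hat x_k(t;0)]$, and $x_k$ is restricted to that interval in P3. Electricity prices are non-negative throughout. Problem P3 (in each slot $t$): minimize $\sum_{i=1}^If_i^{\rm Gen}(p_i(t))-\sum_{k=1}^Ku_k^{(t)}(x_k(t))$ over $p_i(t),x_k(t)$ subject to (i) $\sum_ip_i(t)=\sum_jd_j(t)+\sum_kx_k(t)$; (ii) $0\le x_k(t)\le X_k(t)$ for all $k$; (iii) $\underline P_i\le p_i(t)\le\overline P_i$ for all $i$; (iv) $-F_l\le p_l^{\rm line}(t)\le F_l$ for all lines $l$, where $p_l^{\rm line}(t)=\sum_i\delta_{il}p_i(t)-\sum_j\delta_{jl}d_j(t)-\sum_k\delta_{kl}x_k(t)$ with given real constants $\delta_{il},\delta_{jl},\delta_{kl}$ (power transfer distribution factors). Each $f_i^{\rm Gen}$ is convex. Locational marginal price: $\pi_k(t)=\lambda(t)+\sum_l(\delta_{kl}\underline\chi_l(t)-\delta_{kl}\overline\chi_l(t))$, where $\lambda(t)\in\mathbb R$ and $\underline\chi_l(t),\overline\chi_l(t)\ge0$ are dual variables for (i) and for the lower and upper bounds in (iv), with Lagrangian $$\sum_if_i^{\rm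 Gen}(p_i)-\sum_ku_k(x_k)+\lambda\Big(\sum_jd_j+\sum_kx_k-\sum_ip_i\Big)+\sum_l\Big(\underline\chi_l(-F_l-p_l^{\rm line})+\overline\chi_l(p_l^{\rm line}-F_l)\Big).$$ $\pi_k^*(t)$ is this price evaluated at optimal dual variables of P3. *)

theory Defs
  imports "HOL-Analysis.Analysis"
begin

text \<open>
  The index types \<open>'i\<close>, \<open>'j\<close>, \<open>'k\<close>, \<open>'l\<close>, \<open>'t\<close> stand for generators, fixed loads,
  aggregators, lines and time slots. The groups of aggregator \<open>k\<close> are \<open>1, \<dots>, ngroups M k\<close>.
\<close>

record ('i, 'j, 'k, 'l, 't) market =
  ngroups :: "'k \<Rightarrow> nat"
  Xmax :: "'k \<Rightarrow> nat \<Rightarrow> 't \<Rightarrow> real"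
  qlog :: "'k \<Rightarrow> nat \<Rightarrow> 't \<Rightarrow> real"
  zlog :: "'k \<Rightarrow> nat \<Rightarrow> 't \<Rightarrow> real"
  Vpar :: real
  load :: "'j \<Rightarrow> 't \<Rightarrow> real"
  gen_cost :: "'i \<Rightarrow> real \<Rightarrow> real"
  Pmin :: "'i \<Rightarrow> real"
  Pmax :: "'i \<Rightarrow> real"
  Fmax :: "'l \<Rightarrow> real"
  ptdf_gen :: "'i \<Rightarrow> 'l \<Rightarrow> real"
  ptdf_load :: "'j \<Rightarrow> 'l \<Rightarrow> real"
  ptdf_ev :: "'k \<Rightarrow> 'l \<Rightarrow> real"


section \<open>The aggregator's charging problem\<close>

text \<open>Schedules are extensional functions, so that the optimal one is unique as a function.\<close>

definition p2_feasible :: "('i, 'j, 'k, 'l, 't) market \<Rightarrow> 'k \<Rightarrow> 't \<Rightarrow> (nat \<Rightarrow> real) set" where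
  "p2_feasible M k t = (\<Pi>\<^sub>E g\<in>{1..ngroups M k}. {0..Xmax M k g t})"

definition p2_cost :: "('i, 'j, 'k, 'l, 't) market \<Rightarrow> 'k \<Rightarrow> 't \<Rightarrow> real \<Rightarrow> (nat \<Rightarrow> real) \<Rightarrow> real" where
  "p2_cost M k t \<pi> x =
     (\<Sum>g=1..ngroups M k. (Vpar M * \<pi> - qlog M k g t - zlog M k g t) * x g)
     + (\<Sum>g=1..ngroups M k. 1/2 * (x g)\<^sup>2)"

definition p2_optimal :: "('i, 'j, 'k, 'l, 't) market \<Rightarrow> 'k \<Rightarrow> 't \<Rightarrow> real \<Rightarrow> (nat \<Rightarrow> real) \<Rightarrow> bool" where
  "p2_optimal M k t \<pi> x \<longleftrightarrow>
     x \<in> p2_feasible M k t \<and> (\<forall>y\<in>p2_feasible M k t. p2_cost M k t \<pi> x \<le> p2_cost M k t \<pi> y)"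

definition ev_schedule :: "('i, 'j, 'k, 'l, 't) market \<Rightarrow> 'k \<Rightarrow> 't \<Rightarrow> real \<Rightarrow> nat \<Rightarrow> real" where
  "ev_schedule M k t \<pi> = (THE x. p2_optimal M k t \<pi> x)"

definition ev_demand :: "('i, 'j, 'k, 'l, 't) market \<Rightarrow> 'k \<Rightarrow> 't \<Rightarrow> real \<Rightarrow> real" where
  "ev_demand M k t \<pi> = (\<Sum>g=1..ngroups M k. ev_schedule M k t \<pi> g)"

text \<open>The definite description in \<^const>\<open>ev_schedule\<close> is proper.\<close>

lemma ex1_p2_optimal:
  assumes X: "\<And>g. g \<in> {1..ngroups M k} \<Longrightarrow> 0 \<le> Xmax M k g t"
  shows "\<exists>!x. p2_optimal M k t \<pi> x"
proof -
  let ?G = "{1..ngroups M k}"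
  define c where "c g = Vpar M * \<pi> - qlog M k g t - zlog M k g t" for g
  define y where "y = (\<lambda>g\<in>?G. max 0 (min (Xmax M k g t) (- c g)))"
  have cost: "p2_cost M k t \<pi> x = (\<Sum>g\<in>?G. c g * x g + (x g)\<^sup>2 / 2)" for x
    by (simp add: p2_cost_def c_def sum.distrib)
  have y: "y \<in> p2_feasible M k t"
    using X by (auto simp: p2_feasible_def y_def)
  have gap: "p2_cost M k t \<pi> y + (\<Sum>g\<in>?G. (x g - y g)\<^sup>2 / 2) \<le> p2_cost M k t \<pi> x"
    if x: "x \<in> p2_feasible M k t" for x
    unfolding cost sum.distrib[symmetric]
  proof (rule sum_mono)
    fix g assume g: "g \<in> ?G"
    have xg: "0 \<le> x g" "x g \<le> Xmax M k g t"
      using x g by (auto simp: p2_feasible_def PiE_iff)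
    have "0 \<le> (c g + y g) * (x g - y g)"
      using xg X[OF g] g
      by (cases "- c g \<le> 0"; cases "Xmax M k g t \<le> - c g")
         (auto simp: y_def max_def min_def zero_le_mult_iff)
    then show "c g * y g + (y g)\<^sup>2 / 2 + (x g - y g)\<^sup>2 / 2 \<le> c g * x g + (x g)\<^sup>2 / 2"
      by (simp add: power2_eq_square field_simps)
  qed
  show ?thesis
  proof (rule ex1I)
    have "p2_cost M k t \<pi> y \<le> p2_cost M k t \<pi> x" if "x \<in> p2_feasible M k t" for x
      using gap[OF that] sum_nonneg[of ?G "\<lambda>g. (x g - y g)\<^sup>2 / 2"] by simp
    with y show "p2_optimal M k t \<pi> y"
      by (simp add: p2_optimal_def)
  next
    fix x assume opt: "p2_optimal M k t \<pi> x"
    then have x: "x \<in> p2_feasible M k t" by (simp add: p2_optimal_def)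
    have "(\<Sum>g\<in>?G. (x g - y g)\<^sup>2 / 2) \<le> 0"
      using opt y gap[OF x] unfolding p2_optimal_def by force
    then have "(\<Sum>g\<in>?G. (x g - y g)\<^sup>2 / 2) = 0"
      by (intro antisym sum_nonneg) auto
    then have "\<forall>g\<in>?G. x g = y g"
      by (subst (asm) sum_nonneg_eq_0_iff) auto
    with x y show "x = y"
      unfolding p2_feasible_def by (intro PiE_ext[where k="?G"]) auto
  qed
qed


section \<open>Bidding curves\<close>

text \<open>
  By continuity and monotonicity the range of the demand function over nonnegative prices is the interval from
  0 to the demand at price 0; any selection of prices generating these demands is admitted.
\<close>

definition inverse_demand :: "('i, 'j, 'k, 'l, 't) market \<Rightarrow> 'k \<Rightarrow> 't \<Rightarrow> (real \<Rightarrow> real) \<Rightarrow> bool" where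
  "inverse_demand M k t h \<longleftrightarrow>
     (\<forall>x\<in>{0..ev_demand M k t 0}. 0 \<le> h x \<and> ev_demand M k t (h x) = x)"

definition bid_curve :: "(real \<Rightarrow> real) \<Rightarrow> real \<Rightarrow> real" where
  "bid_curve h x = integral {0..x} h"


section \<open>The market clearing problem and its dual\<close>

definition line_flow ::
    "('i::finite, 'j::finite, 'k::finite, 'l, 't) market \<Rightarrow> 't \<Rightarrow> ('i \<Rightarrow> real) \<Rightarrow> ('k \<Rightarrow> real) \<Rightarrow> 'l \<Rightarrow> real" where
  "line_flow M t p x l =
     (\<Sum>i\<in>UNIV. ptdf_gen M i l * p i) - (\<Sum>j\<in>UNIV. ptdf_load M j l * load M j t)
     - (\<Sum>k\<in>UNIV. ptdf_ev M k l * x k)"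

text \<open>
  The constraints that are not dualized. The last conjunct restricts \<open>x k\<close> to the domain of the
  bidding curve, which matters when the demand at price 0 is below the total charging power.
\<close>

definition p3_box ::
    "('i, 'j, 'k, 'l, 't) market \<Rightarrow> 't \<Rightarrow> (('i \<Rightarrow> real) \<times> ('k \<Rightarrow> real)) set" where
  "p3_box M t = {(p, x).
     (\<forall>i. Pmin M i \<le> p i \<and> p i \<le> Pmax M i) \<and>
     (\<forall>k. 0 \<le> x k \<and> x k \<le> (\<Sum>g=1..ngroups M k. Xmax M k g t) \<and> x k \<le> ev_demand M k t 0)}"

definition p3_feasible ::
    "('i::finite, 'j::finite, 'k::finite, 'l, 't) market \<Rightarrow> 't \<Rightarrow> (('i \<Rightarrow> real) \<times> ('k \<Rightarrow> real)) set" where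
  "p3_feasible M t = {(p, x) \<in> p3_box M t.
     (\<Sum>i\<in>UNIV. p i) = (\<Sum>j\<in>UNIV. load M j t) + (\<Sum>k\<in>UNIV. x k) \<and>
     (\<forall>l. - Fmax M l \<le> line_flow M t p x l \<and> line_flow M t p x l \<le> Fmax M l)}"

definition p3_cost ::
    "('i::finite, 'j, 'k::finite, 'l, 't) market \<Rightarrow> ('k \<Rightarrow> real \<Rightarrow> real) \<Rightarrow>
     ('i \<Rightarrow> real) \<Rightarrow> ('k \<Rightarrow> real) \<Rightarrow> real" where
  "p3_cost M u p x = (\<Sum>i\<in>UNIV. gen_cost M i (p i)) - (\<Sum>k\<in>UNIV. u k (x k))"

definition p3_optimal ::
    "('i::finite, 'j::finite, 'k::finite, 'l, 't) market \<Rightarrow> 't \<Rightarrow> ('k \<Rightarrow> real \<Rightarrow> real) \<Rightarrow>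
     ('i \<Rightarrow> real) \<Rightarrow> ('k \<Rightarrow> real) \<Rightarrow> bool" where
  "p3_optimal M t u p x \<longleftrightarrow>
     (p, x) \<in> p3_feasible M t \<and> (\<forall>(p', x')\<in>p3_feasible M t. p3_cost M u p x \<le> p3_cost M u p' x')"

definition p3_lagrangian ::
    "('i::finite, 'j::finite, 'k::finite, 'l::finite, 't) market \<Rightarrow> 't \<Rightarrow> ('k \<Rightarrow> real \<Rightarrow> real) \<Rightarrow>
     ('i \<Rightarrow> real) \<Rightarrow> ('k \<Rightarrow> real) \<Rightarrow> real \<Rightarrow> ('l \<Rightarrow> real) \<Rightarrow> ('l \<Rightarrow> real) \<Rightarrow> real" where
  "p3_lagrangian M t u p x lam chi_lo chi_up =
     p3_cost M u p x
     + lam * ((\<Sum>j\<in>UNIV. load M j t) + (\<Sum>k\<in>UNIV. x k) - (\<Sum>i\<in>UNIV. p i))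
     + (\<Sum>l\<in>UNIV. chi_lo l * (- Fmax M l - line_flow M t p x l)
                + chi_up l * (line_flow M t p x l - Fmax M l))"

definition p3_dual ::
    "('i::finite, 'j::finite, 'k::finite, 'l::finite, 't) market \<Rightarrow> 't \<Rightarrow> ('k \<Rightarrow> real \<Rightarrow> real) \<Rightarrow>
     real \<Rightarrow> ('l \<Rightarrow> real) \<Rightarrow> ('l \<Rightarrow> real) \<Rightarrow> ereal" where
  "p3_dual M t u lam chi_lo chi_up =
     (INF (p, x)\<in>p3_box M t. ereal (p3_lagrangian M t u p x lam chi_lo chi_up))"

definition p3_dual_optimal ::
    "('i::finite, 'j::finite, 'k::finite, 'l::finite, 't) market \<Rightarrow> 't \<Rightarrow> ('k \<Rightarrow> real \<Rightarrow> real) \<Rightarrow>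
     real \<Rightarrow> ('l \<Rightarrow> real) \<Rightarrow> ('l \<Rightarrow> real) \<Rightarrow> bool" where
  "p3_dual_optimal M t u lam chi_lo chi_up \<longleftrightarrow>
     (\<forall>l. 0 \<le> chi_lo l \<and> 0 \<le> chi_up l) \<and>
     (\<forall>lam' chi_lo' chi_up'. (\<forall>l. 0 \<le> chi_lo' l \<and> 0 \<le> chi_up' l) \<longrightarrow>
        p3_dual M t u lam' chi_lo' chi_up' \<le> p3_dual M t u lam chi_lo chi_up)"

definition lmp ::
    "('i, 'j, 'k, 'l::finite, 't) market \<Rightarrow> real \<Rightarrow> ('l \<Rightarrow> real) \<Rightarrow> ('l \<Rightarrow> real) \<Rightarrow> 'k \<Rightarrow> real" where
  "lmp M lam chi_lo chi_up k =
     lam + (\<Sum>l\<in>UNIV. ptdf_ev M k l * chi_lo l - ptdf_ev M k l * chi_up l)"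

end

theory Submission
  imports Defs
begin

text \<open>
  If strong duality holds for the clearing problem, its optimal solution minimizes the Lagrangian at
  the optimal multipliers over the constraints that are not dualized. The Lagrangian is a sum of
  functions of single variables (\<open>p3_lagrangian_separable\<close>), and \<open>x\<^sub>k\<close> enters it only through
  \<open>\<pi>\<^sub>k x\<^sub>k - u\<^sub>k x\<^sub>k\<close>, where \<open>\<pi>\<^sub>k\<close> is the locational marginal price. So \<open>x\<^sub>k\<close> maximizes the surplus
  \<open>u\<^sub>k x - \<pi>\<^sub>k x\<close> over the domain of the bidding curve. As \<open>u\<^sub>k\<close> is the integral of an inverse
  of the demand function, the maximizer is the demand at price \<open>\<pi>\<^sub>k\<close>
  (\<open>surplus_maximizer_eq_demand\<close>).

  The delicate point is strong duality, since neither a Slater condition nor continuity of the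
  generation costs is assumed: a convex cost may jump upwards at an end of its capacity interval, and
  then the optimal values of the primal and the dual problem can differ. For this reason
  each cost \<open>f\<^sub>i\<close> is compared with a continuous convex minorant \<open>g\<^sub>i\<close> that agrees with it inside
  the interval (\<open>convex_on_Icc_continuous_minorant\<close>).

  For the problem with the costs \<open>g\<^sub>i\<close> a separating hyperplane gives, for each \<open>\<epsilon> > 0\<close>,
  multipliers whose dual value is at least the optimal value minus \<open>\<epsilon>\<close>
  (\<open>approximate_multiplier_exists\<close>). Hence the multipliers that are optimal for the costs \<open>f\<^sub>i\<close> have
  a dual value of at least the optimal value for \<open>g\<^sub>i\<close>. Two arguments along segments transfer the rest:
  the optimal solution for \<open>f\<^sub>i\<close> is also optimal for \<open>g\<^sub>i\<close> (\<open>p3_optimal_gen_cost_minorant\<close>), because a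
  generator whose output varies along a segment of the interval is strictly inside it between the end
  points; and a lower bound on the Lagrangian for \<open>f\<^sub>i\<close> is one for \<open>g\<^sub>i\<close> too
  (\<open>p3_lagrangian_gen_cost_minorant\<close>). So the solution does minimize the Lagrangian with
  the costs \<open>g\<^sub>i\<close>, which has the same dependence on \<open>x\<close>.
\<close>

section \<open>Convex functions on an interval\<close>

lemma convex_combination_in_interior:
  fixes x y :: real
  assumes "x \<in> {a..b}" "y \<in> {a..b}" "x \<noteq> y" "0 < s" "s < 1"
  shows "(1 - s) * x + s * y \<in> {a<..<b}"
proof -
  have "(1 - s) * x + s * y = x + s * (y - x)" "(1 - s) * x + s * y = y + (1 - s) * (x - y)"
    by (simp_all add: algebra_simps)
  moreover have "x < y \<Longrightarrow> 0 < s * (y - x)" "x < y \<Longrightarrow> (1 - s) * (x - y) < 0"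
    "y < x \<Longrightarrow> s * (y - x) < 0" "y < x \<Longrightarrow> 0 < (1 - s) * (x - y)"
    using assms(4,5) by (auto intro: mult_pos_pos mult_pos_neg)
  ultimately show ?thesis
    using assms(1-3) unfolding atLeastAtMost_iff greaterThanLessThan_iff by linarith
qed

text \<open>
  The minorant is the supremum of the support lines at interior points. It is lower semicontinuous as
  such a supremum, and upper semicontinuous at the end points because it lies below its chord.
\<close>

lemma convex_on_Icc_continuous_minorant:
  fixes f :: "real \<Rightarrow> real"
  assumes f: "convex_on {a..b} f"
  shows "\<exists>g. convex_on {a..b} g \<and> continuous_on {a..b} g \<and>
    (\<forall>x\<in>{a..b}. g x \<le> f x) \<and> (\<forall>x\<in>{a<..<b}. g x = f x) \<and> (a = b \<longrightarrow> g a = f a)"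
proof (cases "a < b")
  case False
  then show ?thesis
    using f by (intro exI[of _ f]) (cases "a = b"; simp)
next
  case ab: True
  define m where "m c = Inf ((\<lambda>t. (f c - f t) / (c - t)) ` ({c<..} \<inter> {a..b}))" for c
  have sup: "f c + m c * (x - c) \<le> f x" if "c \<in> {a<..<b}" "x \<in> {a..b}" for c x
    using convex_le_Inf_differential[OF f, of c x] that by (simp add: m_def)
  define g where "g x = (SUP c\<in>{a<..<b}. f c + m c * (x - c))" for x
  have bdd: "bdd_above ((\<lambda>c. f c + m c * (x - c)) ` {a<..<b})" if "x \<in> {a..b}" for x
    using sup[OF _ that] by (auto intro!: bdd_aboveI[of _ "f x"])
  have ne: "{a<..<b} \<noteq> {}" using ab by simp
  have ge: "f c + m c * (x - c) \<le> g x" if "c \<in> {a<..<b}" "x \<in> {a..b}" for c x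
    unfolding g_def by (rule cSUP_upper[OF that(1) bdd[OF that(2)]])
  have g_le: "g x \<le> f x" if "x \<in> {a..b}" for x
    unfolding g_def by (rule cSUP_least[OF ne]) (use sup that in auto)
  have g_eq: "g x = f x" if "x \<in> {a<..<b}" for x
    using ge[of x x] g_le[of x] that by force
  have cvx: "convex_on {a..b} g"
  proof (rule convex_onI)
    fix t x y :: real
    assume t: "0 < t" "t < 1" and xy: "x \<in> {a..b}" "y \<in> {a..b}"
    show "g ((1 - t) *\<^sub>R x + t *\<^sub>R y) \<le> (1 - t) * g x + t * g y"
      unfolding g_def[of "(1 - t) *\<^sub>R x + t *\<^sub>R y"]
    proof (rule cSUP_least[OF ne])
      fix c assume c: "c \<in> {a<..<b}"
      have "f c + m c * ((1 - t) *\<^sub>R x + t *\<^sub>R y - c)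
          = (1 - t) * (f c + m c * (x - c)) + t * (f c + m c * (y - c))"
        by (simp add: algebra_simps)
      also have "\<dots> \<le> (1 - t) * g x + t * g y"
        using t ge[OF c xy(1)] ge[OF c xy(2)] by (intro add_mono mult_left_mono) auto
      finally show "f c + m c * ((1 - t) *\<^sub>R x + t *\<^sub>R y - c) \<le> (1 - t) * g x + t * g y" .
    qed
  qed simp
  \<comment> \<open>lower semicontinuity\<close>
  have lower: "\<forall>\<^sub>F x in at z within {a..b}. r < g x" if z: "z \<in> {a..b}" and r: "r < g z" for z r
  proof -
    obtain c where c: "c \<in> {a<..<b}" "r < f c + m c * (z - c)"
      using r unfolding g_def less_cSUP_iff[OF ne bdd[OF z]] by blast
    have "((\<lambda>x. f c + m c * (x - c)) \<longlongrightarrow> f c + m c * (z - c)) (at z within {a..b})"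
      by (intro tendsto_intros)
    then have "\<forall>\<^sub>F x in at z within {a..b}. r < f c + m c * (x - c)"
      using c(2) by (rule order_tendstoD)
    then show ?thesis
      unfolding eventually_at_topological by (meson ge[OF c(1)] less_le_trans)
  qed
  have chord: "g x \<le> g a + (x - a) / (b - a) * (g b - g a)" if "x \<in> {a..b}" for x
  proof -
    define t where "t = (x - a) / (b - a)"
    have t: "0 \<le> t" "t \<le> 1" using that ab by (auto simp: t_def)
    have x: "x = (1 - t) *\<^sub>R a + t *\<^sub>R b"
    proof -
      have "t * (b - a) = x - a" using ab by (simp add: t_def)
      then show ?thesis by (simp add: algebra_simps)
    qed
    have "g x \<le> (1 - t) * g a + t * g b"
      using convex_onD[OF cvx t, of a b] ab x by simp
    then show ?thesis by (simp add: t_def[symmetric] algebra_simps)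
  qed
  have "(g \<longlongrightarrow> g z) (at z within {a..b})" if z: "z \<in> {a..b}" for z
  proof (cases "z \<in> {a<..<b}")
    case True
    have "convex_on {a<..<b} f"
      by (rule convex_on_subset[OF f]) auto
    then have "continuous_on {a<..<b} f"
      by (intro convex_on_continuous) auto
    then have "continuous_on {a<..<b} g"
      using g_eq by (subst continuous_on_cong[OF refl]) auto
    then have "isCont g z"
      using True by (simp add: continuous_on_eq_continuous_at)
    then show ?thesis
      unfolding isCont_def by (rule tendsto_within_subset) simp
  next
    case False
    let ?u = "\<lambda>x. g a + (x - a) / (b - a) * (g b - g a)"
    have uz: "?u z = g z" using False z ab by auto
    have lim: "(?u \<longlongrightarrow> ?u z) (at z within {a..b})"
      using ab by (intro tendsto_intros) auto
    show ?thesis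
    proof (rule order_tendstoI)
      fix r assume "g z < r"
      then have "\<forall>\<^sub>F x in at z within {a..b}. ?u x < r"
        using order_tendstoD(2)[OF lim] uz by simp
      then show "\<forall>\<^sub>F x in at z within {a..b}. g x < r"
        using chord by (auto simp: eventually_at_topological intro: le_less_trans)
    qed (use lower z in auto)
  qed
  then have "continuous_on {a..b} g"
    by (simp add: continuous_on_def)
  with cvx g_le g_eq ab show ?thesis by (intro exI[of _ g]) auto
qed

section \<open>Duality without constraint qualification\<close>

text \<open>
  The constraint is \<open>G z \<le> 0\<close> in the order of the closed convex cone \<open>K\<close>. Compactness of \<open>S\<close> closes
  the set \<open>A\<close> of all upper bounds of constraint and cost values, so that the point \<open>(0, v - e)\<close> can be
  separated strictly from it; strictness and one feasible point then make the hyperplane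
  nonvertical. Multipliers that work for \<open>e = 0\<close> need not exist.
\<close>

lemma approximate_multiplier_exists:
  fixes F :: "'a::euclidean_space \<Rightarrow> real" and G :: "'a \<Rightarrow> 'b::euclidean_space"
  assumes S: "compact S" "convex_on S F" "continuous_on S F"
    and G: "continuous_on S G"
    and affine: "\<And>s z w. 0 \<le> s \<Longrightarrow> s \<le> 1 \<Longrightarrow> z \<in> S \<Longrightarrow> w \<in> S \<Longrightarrow>
      G ((1 - s) *\<^sub>R z + s *\<^sub>R w) = (1 - s) *\<^sub>R G z + s *\<^sub>R G w"
    and K: "closed K" "convex K" "cone K"
    and feasible: "z0 \<in> S" "- G z0 \<in> K"
    and v: "\<And>z. z \<in> S \<Longrightarrow> - G z \<in> K \<Longrightarrow> v \<le> F z"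
    and e: "e > 0"
  shows "\<exists>\<mu>. (\<forall>k\<in>K. 0 \<le> inner \<mu> k) \<and> (\<forall>z\<in>S. v - e \<le> F z + inner \<mu> (G z))"
proof -
  define A where "A = (\<Union>y\<in>(\<lambda>z. (G z, F z)) ` S. \<Union>k\<in>K \<times> {0..}. {y + k})"
  have A: "(G z + k, F z + t) \<in> A" if "z \<in> S" "k \<in> K" "0 \<le> t" for z k t
    unfolding A_def
    by (intro UN_I[of "(G z, F z)"] UN_I[of "(k, t)"]) (use that in auto)
  have clo: "closed A"
    unfolding A_def
    by (intro compact_closed_sums compact_continuous_image continuous_intros S G closed_Times K)
  have "(0, v - e) \<notin> A"
  proof
    assume "(0, v - e) \<in> A"
    then obtain z k t where z: "z \<in> S" "k \<in> K" "0 \<le> t" "0 = G z + k" "v - e = F z + t"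
      unfolding A_def by auto
    then have "- G z \<in> K" by (simp add: eq_neg_iff_add_eq_0 add.commute minus_unique)
    from v[OF z(1) this] z(3,5) e show False by linarith
  qed
  moreover have "convex A"
  proof (rule convexI)
    fix y y' :: "'b \<times> real" and u w :: real
    assume y: "y \<in> A" and y': "y' \<in> A" and u: "0 \<le> u" "0 \<le> w" "u + w = 1"
    obtain z k t where z: "z \<in> S" "k \<in> K" "0 \<le> t" "y = (G z + k, F z + t)"
      using y unfolding A_def by auto
    obtain z' k' t' where z': "z' \<in> S" "k' \<in> K" "0 \<le> t'" "y' = (G z' + k', F z' + t')"
      using y' unfolding A_def by auto
    have u1: "u = 1 - w" using u by simp
    let ?z = "u *\<^sub>R z + w *\<^sub>R z'"
    have zS: "?z \<in> S"
      using convex_on_imp_convex[OF S(2)] z(1) z'(1) u by (rule convexD)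
    have kK: "u *\<^sub>R k + w *\<^sub>R k' \<in> K"
      using K(2) z(2) z'(2) u by (rule convexD)
    have Gz: "G ?z = u *\<^sub>R G z + w *\<^sub>R G z'"
      using affine[of w z z'] u z z' by (simp add: u1)
    have Fz: "F ?z \<le> u * F z + w * F z'"
      using convex_onD[OF S(2), of w z z'] u z z' by (simp add: u1)
    have "0 \<le> u * t" "0 \<le> w * t'" using u z(3) z'(3) by simp_all
    then have "(G ?z + (u *\<^sub>R k + w *\<^sub>R k'),
        F ?z + (u * (F z + t) + w * (F z' + t') - F ?z)) \<in> A"
      using Fz by (intro A zS kK) (simp add: algebra_simps)
    moreover have "u *\<^sub>R y + w *\<^sub>R y' = (G ?z + (u *\<^sub>R k + w *\<^sub>R k'),
        F ?z + (u * (F z + t) + w * (F z' + t') - F ?z))"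
      by (simp add: z(4) z'(4) Gz algebra_simps)
    ultimately show "u *\<^sub>R y + w *\<^sub>R y' \<in> A" by (simp only:)
  qed
  ultimately obtain n \<beta> where n: "inner n (0, v - e) < \<beta>" "\<forall>y\<in>A. \<beta> < inner n y"
    using separating_hyperplane_closed_point[of A "(0, v - e)"] clo by blast
  obtain \<nu> s where ns: "n = (\<nu>, s)" by (cases n)
  have sv: "s * (v - e) < \<beta>" using n(1) by (simp add: ns)
  have sep: "\<beta> < inner \<nu> (G z + k) + s * (F z + t)" if "z \<in> S" "k \<in> K" "0 \<le> t" for z k t
    using n(2) A[OF that] by (auto simp: ns)
  have K0: "0 \<in> K" using K(3) feasible(2) cone_0 cone_def by (metis scaleR_zero_left order_refl)
  \<comment> \<open>The linear form is bounded below on \<open>A\<close>, so it is nonnegative on the directions of recession.\<close>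
  have s0: "0 \<le> s"
  proof (rule ccontr)
    assume "\<not> 0 \<le> s"
    define t where "t = max 0 ((\<beta> - inner \<nu> (G z0) - s * F z0) / s)"
    have "s * t \<le> \<beta> - inner \<nu> (G z0) - s * F z0"
      using \<open>\<not> 0 \<le> s\<close> by (simp add: t_def max_def field_simps)
    with sep[OF feasible(1) K0, of t] show False
      by (simp add: t_def algebra_simps)
  qed
  have "s \<noteq> 0"
    using sep[OF feasible, of 0] sv by auto
  with s0 have s: "0 < s" by simp
  have \<nu>K: "0 \<le> inner \<nu> k" if k: "k \<in> K" for k
  proof (rule ccontr)
    assume neg: "\<not> 0 \<le> inner \<nu> k"
    define t where "t = max 0 ((\<beta> - inner \<nu> (G z0) - s * F z0) / inner \<nu> k)"
    have tk: "t *\<^sub>R k \<in> K" using K(3) k by (simp add: cone_def t_def)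
    have "t * inner \<nu> k \<le> \<beta> - inner \<nu> (G z0) - s * F z0"
      using neg by (simp add: t_def max_def field_simps)
    with sep[OF feasible(1) tk, of 0] show False
      by (simp add: inner_add_right)
  qed
  show ?thesis
  proof (intro exI[of _ "\<nu> /\<^sub>R s"] conjI ballI)
    show "0 \<le> inner (\<nu> /\<^sub>R s) k" if "k \<in> K" for k
      using \<nu>K[OF that] s by simp
    fix z assume "z \<in> S"
    then have "s * (v - e) \<le> inner \<nu> (G z) + s * F z"
      using sep[OF _ K0, of z 0] sv by simp
    then show "v - e \<le> F z + inner (\<nu> /\<^sub>R s) (G z)"
      using s by (simp add: field_simps)
  qed
qed

section \<open>Demand of an aggregator\<close>

lemma ev_schedule_optimal:
  assumes "\<And>g. g \<in> {1..ngroups M k} \<Longrightarrow> 0 \<le> Xmax M k g t"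
  shows "p2_optimal M k t \<pi> (ev_schedule M k t \<pi>)"
  unfolding ev_schedule_def using ex1_p2_optimal[OF assms] by (rule theI')

lemma p2_cost_change_price:
  "p2_cost M k t \<pi>' x = p2_cost M k t \<pi> x + Vpar M * (\<pi>' - \<pi>) * (\<Sum>g=1..ngroups M k. x g)"
proof -
  have "(\<Sum>g=1..ngroups M k. (Vpar M * \<pi>' - qlog M k g t - zlog M k g t) * x g)
      = (\<Sum>g=1..ngroups M k. (Vpar M * \<pi> - qlog M k g t - zlog M k g t) * x g
          + Vpar M * (\<pi>' - \<pi>) * x g)"
    by (rule sum.cong) (auto simp: algebra_simps)
  then show ?thesis
    by (simp add: p2_cost_def sum.distrib sum_distrib_left)
qed

lemma ev_demand_antimono:
  assumes X: "\<And>g. g \<in> {1..ngroups M k} \<Longrightarrow> 0 \<le> Xmax M k g t"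
    and V: "Vpar M > 0" and le: "\<pi> \<le> \<pi>'"
  shows "ev_demand M k t \<pi>' \<le> ev_demand M k t \<pi>"
proof (cases "\<pi> = \<pi>'")
  case False
  let ?x = "ev_schedule M k t \<pi>" and ?x' = "ev_schedule M k t \<pi>'"
  have opt: "p2_optimal M k t \<pi> ?x" "p2_optimal M k t \<pi>' ?x'"
    using ev_schedule_optimal[OF X] by blast+
  \<comment> \<open>Each schedule is optimal at its own price; the two inequalities are added.\<close>
  then have "p2_cost M k t \<pi> ?x \<le> p2_cost M k t \<pi> ?x'"
    "p2_cost M k t \<pi>' ?x' \<le> p2_cost M k t \<pi>' ?x"
    by (auto simp: p2_optimal_def)
  then have "Vpar M * (\<pi>' - \<pi>) * ev_demand M k t \<pi>' \<le> Vpar M * (\<pi>' - \<pi>) * ev_demand M k t \<pi>"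
    unfolding ev_demand_def p2_cost_change_price[of M k t \<pi>' _ \<pi>] by linarith
  moreover have "0 < Vpar M * (\<pi>' - \<pi>)" using V le False by simp
  ultimately show ?thesis by (simp only: mult_le_cancel_left_pos)
qed simp

lemma ev_demand_bounds:
  assumes X: "\<And>g. g \<in> {1..ngroups M k} \<Longrightarrow> 0 \<le> Xmax M k g t"
  shows "0 \<le> ev_demand M k t \<pi>" "ev_demand M k t \<pi> \<le> (\<Sum>g=1..ngroups M k. Xmax M k g t)"
proof -
  have "ev_schedule M k t \<pi> g \<in> {0..Xmax M k g t}" if "g \<in> {1..ngroups M k}" for g
    using ev_schedule_optimal[OF X, of \<pi>] that
    by (auto simp: p2_optimal_def p2_feasible_def PiE_iff)
  then show "0 \<le> ev_demand M k t \<pi>" "ev_demand M k t \<pi> \<le> (\<Sum>g=1..ngroups M k. Xmax M k g t)"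
    unfolding ev_demand_def by (auto intro!: sum_nonneg sum_mono)
qed

lemma inverse_demand_antimono:
  assumes X: "\<And>g. g \<in> {1..ngroups M k} \<Longrightarrow> 0 \<le> Xmax M k g t" and V: "Vpar M > 0"
    and h: "inverse_demand M k t h"
  shows "antimono_on {0..ev_demand M k t 0} h"
proof (rule monotone_onI)
  fix x y assume xy: "x \<in> {0..ev_demand M k t 0}" "y \<in> {0..ev_demand M k t 0}" "x \<le> y"
  have "ev_demand M k t (h x) = x" "ev_demand M k t (h y) = y"
    using h xy by (auto simp: inverse_demand_def)
  then show "h y \<le> h x"
    using ev_demand_antimono[OF X V, of "h x" "h y"] xy(3) by force
qed

section \<open>Bidding curves\<close>

lemma antimono_on_integrable:
  fixes h :: "real \<Rightarrow> real"
  assumes "antimono_on {a..b} h"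
  shows "h integrable_on {a..b}"
proof -
  have "mono_on {a..b} (\<lambda>x. - h x)"
    using assms by (auto simp: monotone_on_def)
  then have "(\<lambda>x. - h x) integrable_on {a..b}"
    by (rule integrable_on_mono_on)
  then show ?thesis by (simp add: integrable_neg_iff)
qed

lemma bid_curve_supergradient:
  assumes h: "antimono_on {0..d} h" and m: "m \<in> {0..d}" and y: "y \<in> {0..d}"
  shows "bid_curve h y \<le> bid_curve h m + h m * (y - m)"
proof -
  have int: "h integrable_on {a..b}" if "0 \<le> a" "b \<le> d" for a b
    using h that by (intro antimono_on_integrable) (auto simp: monotone_on_def)
  have split: "bid_curve h b = bid_curve h a + integral {a..b} h" if "0 \<le> a" "a \<le> b" "b \<le> d" for a b
    unfolding bid_curve_def
    using Henstock_Kurzweil_Integration.integral_combine[OF that(1,2) int] that by simp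
  show ?thesis
  proof (cases "m \<le> y")
    case True
    have "integral {m..y} h \<le> integral {m..y} (\<lambda>_. h m)"
      using m y h by (intro integral_le int) (auto simp: monotone_on_def)
    then show ?thesis using split[of m y] m y True by (simp add: algebra_simps)
  next
    case False
    have "integral {y..m} (\<lambda>_. h m) \<le> integral {y..m} h"
      using m y h by (intro integral_le int) (auto simp: monotone_on_def)
    then show ?thesis using split[of y m] m y False by (simp add: algebra_simps)
  qed
qed

lemma bid_curve_concave:
  assumes h: "antimono_on {0..d} h"
  shows "convex_on {0..d} (\<lambda>x. - bid_curve h x)"
proof (rule convex_onI)
  fix s x y :: real
  assume s: "0 < s" "s < 1" and xy: "x \<in> {0..d}" "y \<in> {0..d}"
  let ?m = "(1 - s) *\<^sub>R x + s *\<^sub>R y"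
  have m: "?m \<in> {0..d}"
    using convexD[OF convex_real_interval(5), of x 0 d y "1 - s" s] s xy by simp
  have "(1 - s) * bid_curve h x + s * bid_curve h y
      \<le> (1 - s) * (bid_curve h ?m + h ?m * (x - ?m)) + s * (bid_curve h ?m + h ?m * (y - ?m))"
    using s by (intro add_mono mult_left_mono bid_curve_supergradient[OF h m] xy) auto
  also have "\<dots> = bid_curve h ?m"
    by (simp add: algebra_simps)
  finally show "- bid_curve h ?m \<le> (1 - s) * - bid_curve h x + s * - bid_curve h y"
    by simp
qed simp

lemma bid_curve_continuous:
  assumes "antimono_on {0..d} h"
  shows "continuous_on {0..d} (bid_curve h)"
  using indefinite_integral_continuous_1[OF antimono_on_integrable[OF assms]]
  by (simp add: bid_curve_def[abs_def])

text \<open>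
  The supergradient inequality is used only at the midpoint \<open>m\<close> of \<open>x\<close> and the demand at \<open>\<pi>\<close>: optimality
  of \<open>x\<close> makes \<open>h m - \<pi>\<close> and \<open>m - x\<close> of opposite sign or zero, while monotonicity of the demand makes
  \<open>h m - \<pi>\<close> of the sign of \<open>m - x\<close>, nonzero unless \<open>m = x\<close>. Neither strict concavity of
  the bidding curve nor continuity of the demand is needed.
\<close>

lemma surplus_maximizer_eq_demand:
  assumes X: "\<And>g. g \<in> {1..ngroups M k} \<Longrightarrow> 0 \<le> Xmax M k g t" and V: "Vpar M > 0"
    and h: "inverse_demand M k t h" and \<pi>: "0 \<le> \<pi>"
    and x: "x \<in> {0..ev_demand M k t 0}"
    and opt: "\<And>y. y \<in> {0..ev_demand M k t 0} \<Longrightarrow> \<pi> * x - bid_curve h x \<le> \<pi> * y - bid_curve h y"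
  shows "x = ev_demand M k t \<pi>"
proof -
  let ?d = "ev_demand M k t 0" and ?y = "ev_demand M k t \<pi>"
  define m where "m = (x + ?y) / 2"
  have y: "?y \<in> {0..?d}"
    using ev_demand_antimono[OF X V \<pi>] ev_demand_bounds[OF X] by auto
  have m: "m \<in> {0..?d}" using x y by (auto simp: m_def)
  have hm: "ev_demand M k t (h m) = m" using h m by (auto simp: inverse_demand_def)
  have "bid_curve h x \<le> bid_curve h m + h m * (x - m)"
    by (rule bid_curve_supergradient[OF inverse_demand_antimono[OF X V h] m x])
  with opt[OF m] have "(h m - \<pi>) * (m - x) \<le> 0"
    by (simp add: algebra_simps)
  moreover have "m < ?y \<Longrightarrow> \<pi> < h m" "?y < m \<Longrightarrow> h m < \<pi>"
    using ev_demand_antimono[OF X V, of "h m" \<pi>] ev_demand_antimono[OF X V, of \<pi> "h m"] hm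
    by force+
  ultimately have "\<not> x < ?y" "\<not> ?y < x"
    using mult_pos_pos[of "h m - \<pi>" "m - x"] mult_neg_neg[of "h m - \<pi>" "m - x"]
    by (auto simp: m_def field_simps)
  then show ?thesis by simp
qed

section \<open>The Lagrangian of the clearing problem\<close>

text \<open>
  Collecting the coefficient of each \<open>p i\<close> and each \<open>x k\<close> shows that the Lagrangian charges aggregator
  \<open>k\<close> exactly its locational marginal price.
\<close>

lemma p3_lagrangian_separable:
  fixes M :: "('i::finite, 'j::finite, 'k::finite, 'l::finite, 't) market"
  shows "p3_lagrangian M t u p x lam lo up =
    (\<Sum>i\<in>UNIV. gen_cost M i (p i)
        - (lam + (\<Sum>l\<in>UNIV. ptdf_gen M i l * lo l - ptdf_gen M i l * up l)) * p i)
    + (\<Sum>k\<in>UNIV. lmp M lam lo up k * x k - u k (x k))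
    + (lam * (\<Sum>j\<in>UNIV. load M j t)
       + (\<Sum>l\<in>UNIV. (lo l - up l) * (\<Sum>j\<in>UNIV. ptdf_load M j l * load M j t)
           - (lo l + up l) * Fmax M l))"
proof -
  define a where "a l = (\<Sum>i\<in>UNIV. ptdf_gen M i l * p i)" for l
  define b where "b l = (\<Sum>j\<in>UNIV. ptdf_load M j l * load M j t)" for l
  define c where "c l = (\<Sum>k\<in>UNIV. ptdf_ev M k l * x k)" for l
  have flow: "line_flow M t p x l = a l - b l - c l" for l
    by (simp add: line_flow_def a_def b_def c_def)
  have A: "(\<Sum>i\<in>UNIV. (\<Sum>l\<in>UNIV. ptdf_gen M i l * lo l - ptdf_gen M i l * up l) * p i)
      = (\<Sum>l\<in>UNIV. (lo l - up l) * a l)"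
    unfolding a_def sum_distrib_left sum_distrib_right
    by (subst sum.swap) (auto simp: algebra_simps intro!: sum.cong)
  have C: "(\<Sum>k\<in>UNIV. (\<Sum>l\<in>UNIV. ptdf_ev M k l * lo l - ptdf_ev M k l * up l) * x k)
      = (\<Sum>l\<in>UNIV. (lo l - up l) * c l)"
    unfolding c_def sum_distrib_left sum_distrib_right
    by (subst sum.swap) (auto simp: algebra_simps intro!: sum.cong)
  have L: "(\<Sum>l\<in>UNIV. lo l * (- Fmax M l - line_flow M t p x l) + up l * (line_flow M t p x l - Fmax M l))
     = (\<Sum>l\<in>UNIV. (lo l - up l) * b l - (lo l + up l) * Fmax M l)
       + (\<Sum>l\<in>UNIV. (lo l - up l) * c l) - (\<Sum>l\<in>UNIV. (lo l - up l) * a l)"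
    unfolding sum.distrib[symmetric] sum_subtractf[symmetric]
    by (rule sum.cong) (auto simp: flow algebra_simps)
  have "(\<Sum>i\<in>UNIV. gen_cost M i (p i)
        - (lam + (\<Sum>l\<in>UNIV. ptdf_gen M i l * lo l - ptdf_gen M i l * up l)) * p i)
      = (\<Sum>i\<in>UNIV. gen_cost M i (p i)) - lam * (\<Sum>i\<in>UNIV. p i)
        - (\<Sum>l\<in>UNIV. (lo l - up l) * a l)"
    unfolding A[symmetric] sum_distrib_left sum_subtractf[symmetric]
    by (rule sum.cong) (auto simp: distrib_right)
  moreover have "(\<Sum>k\<in>UNIV. lmp M lam lo up k * x k - u k (x k))
      = lam * (\<Sum>k\<in>UNIV. x k) + (\<Sum>l\<in>UNIV. (lo l - up l) * c l) - (\<Sum>k\<in>UNIV. u k (x k))"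
    unfolding C[symmetric] sum_distrib_left sum_subtractf[symmetric] sum.distrib[symmetric]
    by (rule sum.cong) (auto simp: lmp_def distrib_right)
  ultimately show ?thesis
    unfolding p3_lagrangian_def p3_cost_def L b_def[symmetric] by (simp add: algebra_simps)
qed

lemma line_flow_convex_combination:
  "line_flow M t (\<lambda>i. (1 - s) * p i + s * p' i) (\<lambda>k. (1 - s) * x k + s * x' k) l
    = (1 - s) * line_flow M t p x l + s * line_flow M t p' x' l"
proof -
  have "(\<Sum>i\<in>UNIV. ptdf_gen M i l * ((1 - s) * p i + s * p' i))
      = (1 - s) * (\<Sum>i\<in>UNIV. ptdf_gen M i l * p i) + s * (\<Sum>i\<in>UNIV. ptdf_gen M i l * p' i)"
    unfolding sum_distrib_left sum.distrib[symmetric] by (rule sum.cong) (auto simp: algebra_simps)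
  moreover have "(\<Sum>k\<in>UNIV. ptdf_ev M k l * ((1 - s) * x k + s * x' k))
      = (1 - s) * (\<Sum>k\<in>UNIV. ptdf_ev M k l * x k) + s * (\<Sum>k\<in>UNIV. ptdf_ev M k l * x' k)"
    unfolding sum_distrib_left sum.distrib[symmetric] by (rule sum.cong) (auto simp: algebra_simps)
  ultimately show ?thesis
    by (simp add: line_flow_def algebra_simps)
qed

lemma p3_approximate_multipliers_exist:
  fixes M :: "('i::finite, 'j::finite, 'k::finite, 'l::finite, 't) market"
  assumes gen: "\<And>i. convex_on {Pmin M i..Pmax M i} (gen_cost M i)"
      "\<And>i. continuous_on {Pmin M i..Pmax M i} (gen_cost M i)"
    and util: "\<And>k. convex_on {0..ev_demand M k t 0} (\<lambda>x. - u k x)"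
      "\<And>k. continuous_on {0..ev_demand M k t 0} (u k)"
    and opt: "p3_optimal M t u p x" and e: "e > 0"
  shows "\<exists>lam lo up. (\<forall>l. 0 \<le> lo l \<and> 0 \<le> up l) \<and>
    (\<forall>(p', x')\<in>p3_box M t. p3_cost M u p x - e \<le> p3_lagrangian M t u p' x' lam lo up)"
proof -
  define a b where "a = (\<chi> i. Pmin M i)" and "b = (\<chi> i. Pmax M i)"
  define d where "d = (\<chi> k. min (\<Sum>g=1..ngroups M k. Xmax M k g t) (ev_demand M k t 0))"
  define S where "S = cbox a b \<times> cbox 0 d"
  have S_iff: "z \<in> S \<longleftrightarrow> (($) (fst z), ($) (snd z)) \<in> p3_box M t" for z
    by (cases z) (auto simp: S_def a_def b_def d_def p3_box_def mem_box_cart)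
  have S_fst: "fst z $ i \<in> {Pmin M i..Pmax M i}" and S_snd: "snd z $ k \<in> {0..ev_demand M k t 0}"
    if "z \<in> S" for z i k
    using that by (auto simp: S_iff p3_box_def)
  define F where "F z = p3_cost M u (($) (fst z)) (($) (snd z))" for z :: "(real^'i) \<times> (real^'k)"
  define flow where "flow z l = line_flow M t (($) (fst z)) (($) (snd z)) l"
    for z :: "(real^'i) \<times> (real^'k)" and l
  define G where "G z = ((\<Sum>j\<in>UNIV. load M j t) + (\<Sum>k\<in>UNIV. snd z $ k) - (\<Sum>i\<in>UNIV. fst z $ i),
      ((\<chi> l. - Fmax M l - flow z l), (\<chi> l. flow z l - Fmax M l)))"
    for z :: "(real^'i) \<times> (real^'k)"
  \<comment> \<open>The factor \<open>{0}\<close> belongs to the power balance, whose multiplier is free in sign.\<close>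
  define K :: "(real \<times> (real^'l) \<times> (real^'l)) set"
    where "K = {0} \<times> {v. \<forall>l. 0 \<le> v $ l} \<times> {v. \<forall>l. 0 \<le> v $ l}"
  have G_K: "- G z \<in> K \<longleftrightarrow> (\<Sum>i\<in>UNIV. fst z $ i) = (\<Sum>j\<in>UNIV. load M j t) + (\<Sum>k\<in>UNIV. snd z $ k)
      \<and> (\<forall>l. - Fmax M l \<le> flow z l \<and> flow z l \<le> Fmax M l)" for z
    by (auto simp: G_def K_def) (smt (verit))+
  then have feas: "z \<in> S \<and> - G z \<in> K \<longleftrightarrow> (($) (fst z), ($) (snd z)) \<in> p3_feasible M t" for z
    by (simp add: S_iff p3_feasible_def flow_def)
  define z0 where "z0 = ((\<chi> i. p i), (\<chi> k. x k))"
  have z0: "z0 \<in> S \<and> - G z0 \<in> K"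
    using opt unfolding feas by (simp add: z0_def p3_optimal_def vec_lambda_inverse)
  have min: "p3_cost M u p x \<le> F z" if "z \<in> S" "- G z \<in> K" for z
    using opt feas[of z] that by (auto simp: p3_optimal_def F_def)
  have convS: "convex S" and compS: "compact S"
    unfolding S_def by (auto intro!: convex_Times compact_Times)
  have cvxF: "convex_on S F"
  proof (rule convex_onI[OF _ convS])
    fix s :: real and z w assume s: "0 < s" "s < 1" and zw: "z \<in> S" "w \<in> S"
    let ?y = "(1 - s) *\<^sub>R z + s *\<^sub>R w"
    have "gen_cost M i (fst ?y $ i) \<le> (1 - s) * gen_cost M i (fst z $ i) + s * gen_cost M i (fst w $ i)" for i
      using convex_onD[OF gen(1) _ _ S_fst[OF zw(1)] S_fst[OF zw(2)], of s] s by simp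
    moreover have "- u k (snd ?y $ k) \<le> (1 - s) * - u k (snd z $ k) + s * - u k (snd w $ k)" for k
      using convex_onD[OF util(1) _ _ S_snd[OF zw(1)] S_snd[OF zw(2)], of s] s by simp
    ultimately have "(\<Sum>i\<in>UNIV. gen_cost M i (fst ?y $ i)) + (\<Sum>k\<in>UNIV. - u k (snd ?y $ k))
      \<le> (\<Sum>i\<in>UNIV. (1 - s) * gen_cost M i (fst z $ i) + s * gen_cost M i (fst w $ i))
        + (\<Sum>k\<in>UNIV. (1 - s) * - u k (snd z $ k) + s * - u k (snd w $ k))"
      by (intro add_mono sum_mono)
    then show "F ?y \<le> (1 - s) * F z + s * F w"
      unfolding F_def p3_cost_def
      by (simp add: sum.distrib sum_negf sum_distrib_left[symmetric] sum_subtractf algebra_simps)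
  qed
  have contF: "continuous_on S F"
    unfolding F_def p3_cost_def
    by (intro continuous_intros continuous_on_compose2[OF gen(2)] continuous_on_compose2[OF util(2)])
       (use S_fst S_snd in auto)
  have contG: "continuous_on S G"
    unfolding G_def flow_def line_flow_def by (intro continuous_intros)
  have flow_affine: "flow ((1 - s) *\<^sub>R z + s *\<^sub>R w) l = (1 - s) * flow z l + s * flow w l" for s z w l
    unfolding flow_def line_flow_convex_combination[symmetric]
    by (rule arg_cong2[where f = "\<lambda>p x. line_flow M t p x l"]) (simp_all add: fun_eq_iff)
  have affine: "G ((1 - s) *\<^sub>R z + s *\<^sub>R w) = (1 - s) *\<^sub>R G z + s *\<^sub>R G w" for s z w
    by (simp add: G_def flow_affine vec_eq_iff sum.distrib sum_distrib_left[symmetric])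
       (simp add: algebra_simps)
  have K: "closed K" "convex K" "cone K"
  proof -
    have "closed {v :: real^'l. \<forall>l. 0 \<le> v $ l}"
      by (intro closed_Collect_all closed_Collect_le continuous_intros)
    then show "closed K" unfolding K_def by (intro closed_Times) auto
    show "convex K" by (auto simp: K_def convex_def)
    show "cone K" by (auto simp: K_def cone_def)
  qed
  obtain \<mu> where \<mu>: "\<forall>k\<in>K. 0 \<le> inner \<mu> k" "\<forall>z\<in>S. p3_cost M u p x - e \<le> F z + inner \<mu> (G z)"
    using approximate_multiplier_exists[OF compS cvxF contF contG affine K, of z0 "p3_cost M u p x" e]
      z0 min e by blast
  obtain lam lo up where \<mu>_eq: "\<mu> = (lam, lo, up)" by (cases \<mu>)
  have "0 \<le> lo $ l" "0 \<le> up $ l" for l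
  proof -
    have "(0, axis l 1, 0) \<in> K" "(0, 0, axis l 1) \<in> K"
      by (auto simp: K_def axis_def)
    then have "0 \<le> inner \<mu> (0, axis l 1, 0)" "0 \<le> inner \<mu> (0, 0, axis l 1)"
      using \<mu>(1) by blast+
    then show "0 \<le> lo $ l" "0 \<le> up $ l"
      by (simp_all add: \<mu>_eq inner_axis)
  qed
  moreover have "p3_cost M u p x - e \<le> p3_lagrangian M t u p' x' lam (($) lo) (($) up)"
    if "(p', x') \<in> p3_box M t" for p' x'
    using \<mu>(2)[rule_format, of "((\<chi> i. p' i), (\<chi> k. x' k))"] that
    by (simp add: S_iff \<mu>_eq F_def G_def flow_def p3_lagrangian_def inner_vec_def sum.distrib
        vec_lambda_inverse)
  ultimately show ?thesis by blast
qed

section \<open>Replacing generation costs by continuous minorants\<close>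

lemma p3_box_gen_cost_update [simp]: "p3_box (M\<lparr>gen_cost := c\<rparr>) t = p3_box M t"
  by (simp add: p3_box_def ev_demand_def ev_schedule_def p2_optimal_def[abs_def]
      p2_feasible_def p2_cost_def)

lemma line_flow_gen_cost_update [simp]: "line_flow (M\<lparr>gen_cost := c\<rparr>) = line_flow M"
  by (simp add: fun_eq_iff line_flow_def)

lemma p3_feasible_gen_cost_update [simp]: "p3_feasible (M\<lparr>gen_cost := c\<rparr>) t = p3_feasible M t"
  by (simp add: p3_feasible_def)

lemma ev_demand_gen_cost_update [simp]: "ev_demand (M\<lparr>gen_cost := c\<rparr>) = ev_demand M"
  by (simp add: fun_eq_iff ev_demand_def ev_schedule_def p2_optimal_def[abs_def]
      p2_feasible_def p2_cost_def)

lemma lmp_gen_cost_update [simp]: "lmp (M\<lparr>gen_cost := c\<rparr>) = lmp M"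
  by (simp add: fun_eq_iff lmp_def)

lemma p3_feasible_convex_combination:
  assumes "(p, x) \<in> p3_feasible M t" "(p', x') \<in> p3_feasible M t" "0 \<le> s" "s \<le> 1"
  shows "((\<lambda>i. (1 - s) * p i + s * p' i), (\<lambda>k. (1 - s) * x k + s * x' k)) \<in> p3_feasible M t"
proof -
  have lower: "r \<le> (1 - s) * a + s * b" if "r \<le> a" "r \<le> b" for r a b :: real
    using convex_bound_le[of "- a" "- r" "- b" "1 - s" s] that assms(3,4) by simp
  have upper: "(1 - s) * a + s * b \<le> r" if "a \<le> r" "b \<le> r" for r a b :: real
    using convex_bound_le[of a r b "1 - s" s] that assms(3,4) by simp
  have balance: "(\<Sum>i\<in>UNIV. (1 - s) * p i + s * p' i)
      = (\<Sum>j\<in>UNIV. load M j t) + (\<Sum>k\<in>UNIV. (1 - s) * x k + s * x' k)"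
    using assms(1,2)
    by (simp add: p3_feasible_def sum.distrib sum_distrib_left[symmetric]) (simp add: algebra_simps)
  show ?thesis
    using assms(1,2) balance unfolding p3_feasible_def p3_box_def
    by (simp add: line_flow_convex_combination lower upper)
qed

text \<open>
  On the segment from \<open>(p, x)\<close> to a competitor \<open>(p', x')\<close>, the original cost of a generator is constant
  if \<open>p i = p' i\<close>, and it equals \<open>g i\<close> otherwise; in both cases its increase is at most
  \<open>s * (g i (p' i) - g i (p i))\<close>.
\<close>

lemma p3_optimal_gen_cost_minorant:
  fixes M :: "('i::finite, 'j::finite, 'k::finite, 'l, 't) market"
  assumes g: "\<And>i. convex_on {Pmin M i..Pmax M i} (g i)"
      "\<And>i y. y \<in> {Pmin M i..Pmax M i} \<Longrightarrow> g i y \<le> gen_cost M i y"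
      "\<And>i y. y \<in> {Pmin M i<..<Pmax M i} \<Longrightarrow> g i y = gen_cost M i y"
    and util: "\<And>k. convex_on {0..ev_demand M k t 0} (\<lambda>x. - u k x)"
    and opt: "p3_optimal M t u p x"
  shows "p3_optimal (M\<lparr>gen_cost := g\<rparr>) t u p x"
  unfolding p3_optimal_def p3_feasible_gen_cost_update
proof (intro conjI ballI, goal_cases)
  case 1
  show ?case using opt by (simp add: p3_optimal_def)
next
  case (2 z)
  obtain p' x' where z: "z = (p', x')" by (cases z)
  have feas: "(p, x) \<in> p3_feasible M t" "(p', x') \<in> p3_feasible M t"
    using opt 2 by (auto simp: p3_optimal_def z)
  have P: "p i \<in> {Pmin M i..Pmax M i}" "p' i \<in> {Pmin M i..Pmax M i}" for i
    using feas by (auto simp: p3_feasible_def p3_box_def)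
  have Xr: "x k \<in> {0..ev_demand M k t 0}" "x' k \<in> {0..ev_demand M k t 0}" for k
    using feas by (auto simp: p3_feasible_def p3_box_def)
  let ?M = "M\<lparr>gen_cost := g\<rparr>"
  let ?\<Delta> = "p3_cost ?M u p' x' - p3_cost ?M u p x"
  have step: "0 \<le> s * ?\<Delta>" if s: "0 < s" "s < 1" for s
  proof -
    let ?p = "\<lambda>i. (1 - s) * p i + s * p' i" and ?x = "\<lambda>k. (1 - s) * x k + s * x' k"
    have gen: "gen_cost M i (?p i) - gen_cost M i (p i) \<le> s * (g i (p' i) - g i (p i))" for i
    proof (cases "p i = p' i")
      case True
      then show ?thesis by (simp add: algebra_simps)
    next
      case False
      have "?p i \<in> {Pmin M i<..<Pmax M i}"
        by (rule convex_combination_in_interior[OF P False s])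
      then have "gen_cost M i (?p i) = g i (?p i)" using g(3) by simp
      also have "\<dots> \<le> (1 - s) * g i (p i) + s * g i (p' i)"
        using convex_onD[OF g(1) _ _ P(1,2), of s i] s by simp
      finally show ?thesis
        using g(2)[OF P(1), of i] by (simp add: algebra_simps)
    qed
    have ut: "u k (x k) - u k (?x k) \<le> s * (u k (x k) - u k (x' k))" for k
      using convex_onD[OF util _ _ Xr(1,2), of s k] s by (simp add: algebra_simps)
    have "p3_cost M u p x \<le> p3_cost M u ?p ?x"
      using opt p3_feasible_convex_combination[OF feas, of s] s by (auto simp: p3_optimal_def)
    then have "0 \<le> (\<Sum>i\<in>UNIV. gen_cost M i (?p i) - gen_cost M i (p i))
        + (\<Sum>k\<in>UNIV. u k (x k) - u k (?x k))"
      by (simp add: p3_cost_def sum_subtractf)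
    also have "\<dots> \<le> (\<Sum>i\<in>UNIV. s * (g i (p' i) - g i (p i)))
        + (\<Sum>k\<in>UNIV. s * (u k (x k) - u k (x' k)))"
      by (intro add_mono sum_mono gen ut)
    also have "\<dots> = s * ?\<Delta>"
      by (simp add: p3_cost_def sum_subtractf sum_distrib_left[symmetric] algebra_simps)
    finally show ?thesis .
  qed
  \<comment> \<open>Any \<open>s\<close> strictly between 0 and 1 would do.\<close>
  show ?case using step[of "1/2"] by (simp add: z)
qed

text \<open>
  The point \<open>p\<close> is approached along the segment from the midpoint \<open>m\<close> of the capacity box. On this segment
  short of \<open>p\<close>, the costs \<open>g i\<close> and \<open>gen_cost M i\<close> agree.
\<close>

lemma p3_lagrangian_gen_cost_minorant:
  fixes M :: "('i::finite, 'j::finite, 'k::finite, 'l::finite, 't) market"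
  assumes g: "\<And>i. convex_on {Pmin M i..Pmax M i} (g i)"
      "\<And>i y. y \<in> {Pmin M i<..<Pmax M i} \<Longrightarrow> g i y = gen_cost M i y"
      "\<And>i. Pmin M i = Pmax M i \<Longrightarrow> g i (Pmin M i) = gen_cost M i (Pmin M i)"
    and bound: "\<And>p x. (p, x) \<in> p3_box M t \<Longrightarrow> v \<le> p3_lagrangian M t u p x lam lo up"
    and box: "(p, x) \<in> p3_box M t"
  shows "v \<le> p3_lagrangian (M\<lparr>gen_cost := g\<rparr>) t u p x lam lo up"
proof -
  let ?M = "M\<lparr>gen_cost := g\<rparr>"
  let ?L = "\<lambda>p. p3_lagrangian ?M t u p x lam lo up"
  define m where "m i = (Pmin M i + Pmax M i) / 2" for i
  have P: "p i \<in> {Pmin M i..Pmax M i}" for i using box by (simp add: p3_box_def)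
  then have ab: "Pmin M i \<le> Pmax M i" for i by (meson atLeastAtMost_iff order_trans)
  then have m: "m i \<in> {Pmin M i..Pmax M i}" for i by (simp add: m_def field_simps)
  have step: "v \<le> (1 - s) * ?L p + s * ?L m" if s: "0 < s" "s < 1" for s
  proof -
    let ?p = "\<lambda>i. (1 - s) * p i + s * m i"
    define n where "n i = lam + (\<Sum>l\<in>UNIV. ptdf_gen M i l * lo l - ptdf_gen M i l * up l)" for i
    have "?p i \<in> {Pmin M i..Pmax M i}" for i
      using convexD[OF convex_real_interval(5) P m, of "1 - s" s] s by simp
    then have "v \<le> p3_lagrangian M t u ?p x lam lo up"
      using box by (intro bound) (simp add: p3_box_def)
    moreover have "gen_cost M i (?p i) - n i * ?p i
        \<le> (1 - s) * (g i (p i) - n i * p i) + s * (g i (m i) - n i * m i)" for i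
    proof -
      have "gen_cost M i (?p i) = g i (?p i)"
      proof (cases "Pmin M i = Pmax M i")
        case True
        then show ?thesis using g(3) P[of i] m[of i] by (simp add: algebra_simps)
      next
        case False
        then have "?p i \<in> {Pmin M i<..<Pmax M i}"
          using convex_combination_in_interior[OF P m _ s, of i] ab[of i]
          by (cases "p i = m i") (auto simp: m_def field_simps)
        then show ?thesis using g(2) by simp
      qed
      also have "\<dots> \<le> (1 - s) * g i (p i) + s * g i (m i)"
        using convex_onD[OF g(1) _ _ P m, of s i] s by simp
      finally show ?thesis by (simp add: algebra_simps)
    qed
    then have "(\<Sum>i\<in>UNIV. gen_cost M i (?p i) - n i * ?p i)
        \<le> (\<Sum>i\<in>UNIV. (1 - s) * (g i (p i) - n i * p i) + s * (g i (m i) - n i * m i))"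
      by (rule sum_mono)
    then have "(\<Sum>i\<in>UNIV. gen_cost M i (?p i) - n i * ?p i)
        \<le> (1 - s) * (\<Sum>i\<in>UNIV. g i (p i) - n i * p i) + s * (\<Sum>i\<in>UNIV. g i (m i) - n i * m i)"
      by (simp add: sum.distrib sum_distrib_left)
    ultimately show ?thesis
      unfolding p3_lagrangian_separable
      by (simp add: n_def[symmetric]) (simp add: algebra_simps)
  qed
  have "((\<lambda>s. (1 - s) * ?L p + s * ?L m) \<longlongrightarrow> (1 - 0) * ?L p + 0 * ?L m) (at_right 0)"
    by (intro tendsto_intros)
  moreover have "\<forall>\<^sub>F s in at_right 0. v \<le> (1 - s) * ?L p + s * ?L m"
    using eventually_at_right_real[of 0 "1::real"] by (auto elim!: eventually_mono intro: step)
  ultimately show ?thesis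
    by (intro tendsto_lowerbound[of _ _ "at_right 0"]) auto
qed

section \<open>Alignment\<close>

lemma market_clearing_eq_ev_demand:
  fixes M :: "('i::finite, 'j::finite, 'k::finite, 'l::finite, 't) market"
  assumes V: "Vpar M > 0"
    and X: "\<And>k g. g \<in> {1..ngroups M k} \<Longrightarrow> 0 \<le> Xmax M k g t"
    and cost: "\<And>i. convex_on {Pmin M i..Pmax M i} (gen_cost M i)"
    and h: "\<And>k. inverse_demand M k t (h k)"
    and primal: "p3_optimal M t (\<lambda>k. bid_curve (h k)) p x"
    and dual: "p3_dual_optimal M t (\<lambda>k. bid_curve (h k)) lam lo up"
    and price: "0 \<le> lmp M lam lo up k"
  shows "x k = ev_demand M k t (lmp M lam lo up k)"
proof -
  let ?u = "\<lambda>k. bid_curve (h k)" and ?\<pi> = "lmp M lam lo up"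
  have anti: "antimono_on {0..ev_demand M k t 0} (h k)" for k
    by (rule inverse_demand_antimono[OF X V h])
  obtain g where g: "\<And>i. convex_on {Pmin M i..Pmax M i} (g i)"
      "\<And>i. continuous_on {Pmin M i..Pmax M i} (g i)"
      "\<And>i y. y \<in> {Pmin M i..Pmax M i} \<Longrightarrow> g i y \<le> gen_cost M i y"
      "\<And>i y. y \<in> {Pmin M i<..<Pmax M i} \<Longrightarrow> g i y = gen_cost M i y"
      "\<And>i. Pmin M i = Pmax M i \<Longrightarrow> g i (Pmin M i) = gen_cost M i (Pmin M i)"
    using convex_on_Icc_continuous_minorant[OF cost] by metis
  define M' where "M' = M\<lparr>gen_cost := g\<rparr>"
  define v where "v = p3_cost M' ?u p x"
  have opt': "p3_optimal M' t ?u p x"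
    unfolding M'_def
    by (rule p3_optimal_gen_cost_minorant[OF g(1,3,4) bid_curve_concave[OF anti] primal])
  have feas: "(p, x) \<in> p3_feasible M t" using primal by (simp add: p3_optimal_def)
  then have box: "(p, x) \<in> p3_box M t" by (simp add: p3_feasible_def)
  have le_M: "p3_lagrangian M' t ?u p' x' lam' lo' up' \<le> p3_lagrangian M t ?u p' x' lam' lo' up'"
    if "(p', x') \<in> p3_box M t" for p' x' lam' lo' up'
    using that unfolding p3_lagrangian_def p3_cost_def
    by (auto simp: M'_def p3_box_def intro!: sum_mono g(3))
  \<comment> \<open>The approximate multipliers for the costs \<open>g\<close> only compete in the dual with the original costs.\<close>
  have dual_ge: "ereal (v - e) \<le> p3_dual M t ?u lam lo up" if e: "e > 0" for e
  proof -
    obtain lam' lo' up' where mult: "\<forall>l. 0 \<le> lo' l \<and> 0 \<le> up' l"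
        "\<forall>(p', x')\<in>p3_box M t. v - e \<le> p3_lagrangian M' t ?u p' x' lam' lo' up'"
      using p3_approximate_multipliers_exist[OF _ _ _ _ opt' e]
        g(1,2) bid_curve_concave[OF anti] bid_curve_continuous[OF anti]
      unfolding v_def M'_def by auto
    have "ereal (v - e) \<le> p3_dual M t ?u lam' lo' up'"
      unfolding p3_dual_def using mult(2) le_M by (force intro!: INF_greatest intro: order_trans)
    also have "\<dots> \<le> p3_dual M t ?u lam lo up"
      using dual mult(1) by (simp add: p3_dual_optimal_def)
    finally show ?thesis .
  qed
  have lag_ge: "v \<le> p3_lagrangian M t ?u p' x' lam lo up" if b: "(p', x') \<in> p3_box M t" for p' x'
  proof (rule field_le_epsilon)
    fix e :: real assume "0 < e"
    have "p3_dual M t ?u lam lo up \<le> ereal (p3_lagrangian M t ?u p' x' lam lo up)"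
      unfolding p3_dual_def by (rule INF_lower2[OF b]) simp
    with dual_ge[OF \<open>0 < e\<close>] have "ereal (v - e) \<le> ereal (p3_lagrangian M t ?u p' x' lam lo up)"
      by (rule order_trans)
    then show "v \<le> p3_lagrangian M t ?u p' x' lam lo up + e" by simp
  qed
  have lag'_ge: "v \<le> p3_lagrangian M' t ?u p x' lam lo up" if "(p, x') \<in> p3_box M t" for x'
    unfolding M'_def by (rule p3_lagrangian_gen_cost_minorant[OF g(1,4,5) lag_ge that])
  \<comment> \<open>weak duality, at the optimal solution\<close>
  have lag'_le: "p3_lagrangian M' t ?u p x lam lo up \<le> v"
  proof -
    have "lo l * (- Fmax M l - line_flow M t p x l) + up l * (line_flow M t p x l - Fmax M l) \<le> 0" for l
      using feas dual by (intro add_nonpos_nonpos mult_nonneg_nonpos)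
        (auto simp: p3_feasible_def p3_dual_optimal_def algebra_simps minus_le_iff)
    then have "(\<Sum>l\<in>UNIV. lo l * (- Fmax M l - line_flow M t p x l)
        + up l * (line_flow M t p x l - Fmax M l)) \<le> 0"
      by (intro sum_nonpos) auto
    then show ?thesis
      using feas by (simp add: p3_lagrangian_def v_def M'_def p3_feasible_def)
  qed
  have "?\<pi> k * x k - ?u k (x k) \<le> ?\<pi> k * y - ?u k y" if y: "y \<in> {0..ev_demand M k t 0}" for y
  proof -
    let ?r = "\<lambda>k y. ?\<pi> k * y - ?u k y"
    \<comment> \<open>The Lagrangian is separable, so changing \<open>x k\<close> alone isolates the surplus of \<open>k\<close>.\<close>
    have "(p, x(k := y)) \<in> p3_box M t"
      using box y ev_demand_bounds(2)[where k = k and t = t and \<pi> = 0, OF X] by (auto simp: p3_box_def)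
    from order_trans[OF lag'_le lag'_ge[OF this]]
    have "(\<Sum>j\<in>UNIV. ?r j (x j)) \<le> (\<Sum>j\<in>UNIV. ?r j ((x(k := y)) j))"
      by (simp add: p3_lagrangian_separable M'_def)
    moreover have "(\<Sum>j\<in>UNIV. ?r j (w j)) = ?r k (w k) + (\<Sum>j\<in>UNIV - {k}. ?r j (w j))" for w
      by (rule sum.remove) auto
    moreover have "(\<Sum>j\<in>UNIV - {k}. ?r j ((x(k := y)) j)) = (\<Sum>j\<in>UNIV - {k}. ?r j (x j))"
      by (rule sum.cong) auto
    ultimately show ?thesis by simp
  qed
  moreover have "x k \<in> {0..ev_demand M k t 0}" using box by (simp add: p3_box_def)
  ultimately show ?thesis
    by (intro surplus_maximizer_eq_demand[OF X V h price])
qed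

theorem proposition4:
  fixes M :: "('i::finite, 'j::finite, 'k::finite, 'l::finite, 't) market"
    and h :: "'k \<Rightarrow> 't \<Rightarrow> real \<Rightarrow> real"
    and p :: "'t \<Rightarrow> 'i \<Rightarrow> real" and x :: "'t \<Rightarrow> 'k \<Rightarrow> real"
    and lam :: "'t \<Rightarrow> real" and chi_lo chi_up :: "'t \<Rightarrow> 'l \<Rightarrow> real"
    and price :: "'k \<Rightarrow> 't \<Rightarrow> real"
  assumes V: "Vpar M > 0"
    and X: "\<And>k g t. g \<in> {1..ngroups M k} \<Longrightarrow> Xmax M k g t > 0"
    and q: "\<And>k g t. g \<in> {1..ngroups M k} \<Longrightarrow> qlog M k g t \<ge> 0"
    and z: "\<And>k g t. g \<in> {1..ngroups M k} \<Longrightarrow> zlog M k g t \<ge> 0"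
    and convex_cost: "\<And>i. convex_on {Pmin M i..Pmax M i} (gen_cost M i)"
    and bids: "\<And>k t. inverse_demand M k t (h k t)"
    and primal: "\<And>t. p3_optimal M t (\<lambda>k. bid_curve (h k t)) (p t) (x t)"
    and dual: "\<And>t. p3_dual_optimal M t (\<lambda>k. bid_curve (h k t)) (lam t) (chi_lo t) (chi_up t)"
    and price: "\<And>k t. price k t = lmp M (lam t) (chi_lo t) (chi_up t) k"
    and price_nonneg: "\<And>k t. price k t \<ge> 0"
  shows "\<forall>k t. x t k = (\<Sum>g=1..ngroups M k. ev_schedule M k t (price k t) g)"
  using market_clearing_eq_ev_demand[OF V less_imp_le[OF X] convex_cost bids primal dual] price price_nonneg
  by (simp add: ev_demand_def)

end
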